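(* For continuous 3-player Guts, the payoff function is $\Psi(p_1^*,p_2^*,p_3^* )=\alpha+\beta V$, where $$\beta(p_1^*,p_2^*,p_3^* )=2-p_1^*-p_2^*-p_3^*+2p_1^*p_2^*p_3^*$$ and $$\alpha(p_1^*,p_2^*,p_3^* )=\begin{cases} 2p_1^*-p_2^*-p_3^*+(p_3^* )^3+3(p_2^* )^2p_3^*-4p_1^*p_2^*p_3^*, & p_1^*<p_2^*<p_3^*,\\ 2p_1^*-p_3^*-p_2^*+(p_2^* )^3+3(p_3^* )^2p_2^*-4p_1^*p_2^*p_3^*, & p_1^*<p_3^*<p_2^*,\\ 2p_1^*-p_2^*-p_3^*+(p_3^* )^3-3(p_1^* )^2p_3^*+2p_1^*p_2^*p_3^*, & p_2^*<p_1^*<p_3^*,\\ 2p_1^*-p_2^*-p_3^*+(p_2^* )^3-3(p_1^* )^2p_2^*+2p_1^*p_2^*p_3^*, & p_3^*<p_1^*<p_2^*,\\ 2p_1^*-p_2^*-p_3^*-2(p_1^* )^3+2p_1^*p_2^*p_3^*, & p_2^*<p_3^*<p_1^*,\\ 2p_1^*-p_2^*-p_3^*-2(p_1^* )^3+2p_1^*p_2^*p_3^*, & p_3^*<p_2^*<p_1^*. \end{cases}$$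
   Context: Continuous 3-player Guts: players 1, 2, 3 receive independent hands $p_1,p_2,p_3$ uniform on $[0,1]$. A pure strategy of player $i$ is a threshold $p_i^*\in[0,1]$: hold if $p_i\ge p_i^*$, drop if $p_i<p_i^*$. Each ante is one unit, so the pot is $3$. Let $r$ be the number of holding players. If $r=0$, the immediate return to each player is $0$ and the game is replayed with stakes factor $1$. If $r\ge1$, the stakes factor for the replay is $r-1$ (factor $0$ means the game ends) and a player's immediate return is $(r-2)+3$ if the player holds and has the highest hand among holders, $(r-2)-3$ if the player holds but does not have the highest hand, and $r-2$ if the player drops. $\alpha(p_1^*,p_2^*,p_3^* )$ is the expected immediate return to player 1 and $\beta(p_1^*,p_2^*,p_3^* )$ the expected stakes factor. The payoff function is the expected total return $\Psi=\alpha+\beta V$ to player 1, where $V$ denotes the expected total return from the replayed game at unit stakes. *)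

theory Defs
  imports "HOL-Probability.Probability"
begin

definition players :: "nat set" where
  "players = {1, 2, 3}"

definition deal :: "(nat \<Rightarrow> real) measure" where
  "deal = (\<Pi>\<^sub>M i\<in>players. uniform_measure lborel {0..1})"

text \<open>Below, \<open>p\<close> is the profile of thresholds and \<open>h\<close> the profile of hands.\<close>

definition holders :: "(nat \<Rightarrow> real) \<Rightarrow> (nat \<Rightarrow> real) \<Rightarrow> nat set" where
  "holders p h = {i \<in> players. p i \<le> h i}"

text \<open>Players whose hands tie for the highest would all count as winners; this
  happens with probability zero.\<close>

definition wins :: "(nat \<Rightarrow> real) \<Rightarrow> (nat \<Rightarrow> real) \<Rightarrow> nat \<Rightarrow> bool" where
  "wins p h i \<longleftrightarrow> i \<in> holders p h \<and> (\<forall>j\<in>holders p h. h j \<le> h i)"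

definition stakes_factor :: "(nat \<Rightarrow> real) \<Rightarrow> (nat \<Rightarrow> real) \<Rightarrow> real" where
  "stakes_factor p h =
     (let r = card (holders p h) in if r = 0 then 1 else real r - 1)"

definition immediate_return :: "(nat \<Rightarrow> real) \<Rightarrow> (nat \<Rightarrow> real) \<Rightarrow> nat \<Rightarrow> real" where
  "immediate_return p h i =
     (let r = card (holders p h) in
      if r = 0 then 0
      else if wins p h i then (real r - 2) + 3
      else if i \<in> holders p h then (real r - 2) - 3
      else real r - 2)"

definition alpha :: "(nat \<Rightarrow> real) \<Rightarrow> real" where
  "alpha p = (\<integral>h. immediate_return p h 1 \<partial>deal)"

definition beta :: "(nat \<Rightarrow> real) \<Rightarrow> real" where
  "beta p = (\<integral>h. stakes_factor p h \<partial>deal)"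

text \<open>The replayed game is represented by an arbitrary probability space \<open>R\<close>,
  independent of the current deal, and the total return \<open>W\<close> to player 1 in the
  replayed game at unit stakes. The payoff is the expectation of player 1's total
  return: the immediate return plus the replay return scaled by the stakes factor.\<close>

definition payoff :: "'a measure \<Rightarrow> ('a \<Rightarrow> real) \<Rightarrow> (nat \<Rightarrow> real) \<Rightarrow> real" where
  "payoff R W p =
     (\<integral>(h, w). immediate_return p h 1 + stakes_factor p h * W w \<partial>(deal \<Otimes>\<^sub>M R))"

end

theory Submission
  imports Defs
begin

text \<open>
  The game is determined by who drops and by who wins. Write \<open>D\<^sub>i\<close> for the 0/1-variable
  that player \<open>i\<close> drops. Since there are \<open>3 - (D\<^sub>1 + D\<^sub>2 + D\<^sub>3)\<close> holders and
  nobody holds exactly when \<open>D\<^sub>1 D\<^sub>2 D\<^sub>3 = 1\<close>, the stakes factor is a polynomial in the \<open>D\<^sub>i\<close>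
  (lemma \<open>stakes_factor_eq\<close>), and the immediate return is such a polynomial plus six times
  the 0/1-variable that the player wins (lemma \<open>immediate_return_eq\<close>). The \<open>D\<^sub>i\<close> are
  independent with mean \<open>p i\<close>, so taking expectations yields \<open>\<beta>\<close> at once and reduces \<open>\<alpha>\<close> to
  the probability that player 1 wins.

  Given that player 1 holds a hand \<open>x\<close>, each opponent \<open>j\<close> fails to beat it if \<open>j\<close> drops or has
  a hand of at most \<open>x\<close>, which happens with probability \<open>max (p j) x\<close>. Hence player 1 wins with
  probability \<open>\<integral> max (p 2) x * max (p 3) x\<close> over \<open>x\<close> from \<open>p 1\<close> to \<open>1\<close>
  (lemma \<open>expectation_wins\<close>). Between consecutive breakpoints \<open>p 2\<close>, \<open>p 3\<close> the integrand is a
  constant, a multiple of \<open>x\<close>, or \<open>x ^ 2\<close>, and the cases of the theorem record which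
  breakpoints lie in the range of integration, and in which order.

  Finally \<open>\<Psi> = \<alpha> + \<beta> V\<close> is the factorisation of the expectation of a product of a function of
  the deal and a function of the independent replay.
\<close>

section \<open>Returns as polynomials in the drop indicators\<close>

definition drops :: "(nat \<Rightarrow> real) \<Rightarrow> (nat \<Rightarrow> real) \<Rightarrow> nat \<Rightarrow> real" where
  "drops p h i = indicator {..<p i} (h i)"

lemma card_holders: "real (card (holders p h)) = 3 - (\<Sum>i\<in>players. drops p h i)"
proof -
  have "real (card (holders p h)) = (\<Sum>i\<in>players. of_bool (p i \<le> h i))"
    by (simp add: holders_def players_def Int_def)
  also have "\<dots> = (\<Sum>i\<in>players. 1 - drops p h i)"
    by (intro sum.cong) (auto simp: drops_def indicator_def)
  finally show ?thesis
    by (simp add: sum_subtractf players_def)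
qed

lemma prod_drops: "(\<Prod>i\<in>players. drops p h i) = of_bool (card (holders p h) = 0)"
  by (auto simp: players_def holders_def drops_def indicator_def)

lemma stakes_factor_eq:
  "stakes_factor p h = 2 - (\<Sum>i\<in>players. drops p h i) + 2 * (\<Prod>i\<in>players. drops p h i)"
  unfolding prod_drops using card_holders[of p h] by (auto simp: stakes_factor_def)

text \<open>Every player receives \<open>r - 2\<close> if \<open>r \<ge> 1\<close>, and a holder in addition \<open>-3\<close>, corrected by
  \<open>+6\<close> on winning. If \<open>r = 0\<close> the term \<open>r - 2\<close> is cancelled by twice the product.\<close>

lemma immediate_return_eq:
  assumes "i \<in> players"
  shows "immediate_return p h i = 3 * drops p h i - 2 - (\<Sum>j\<in>players. drops p h j)
      + 2 * (\<Prod>j\<in>players. drops p h j) + 6 * of_bool (wins p h i)"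
proof -
  have "drops p h i = of_bool (i \<notin> holders p h)"
    using assms by (auto simp: drops_def holders_def indicator_def)
  moreover have "card (holders p h) = 0 \<Longrightarrow> i \<notin> holders p h"
    by (auto simp: holders_def players_def)
  moreover have "wins p h i \<Longrightarrow> i \<in> holders p h"
    by (simp add: wins_def)
  ultimately show ?thesis
    unfolding prod_drops using card_holders[of p h] by (auto simp: immediate_return_def Let_def)
qed

lemma wins_1_iff:
  "wins p h 1 \<longleftrightarrow> p 1 \<le> h 1 \<and> (\<forall>j\<in>{2, 3}. h j < p j \<or> h j \<le> h 1)"
  by (auto simp: wins_def holders_def players_def)

section \<open>The distribution of the hands\<close>

abbreviation hand :: "real measure" where
  "hand \<equiv> uniform_measure lborel {0..1}"

interpretation hand: prob_space hand
  by (rule prob_space_uniform_measure) auto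

interpretation hands: product_prob_space "\<lambda>_. hand" I for I :: "nat set"
  by unfold_locales

interpretation deal: prob_space deal
  unfolding deal_def by (intro prob_space_PiM hand.prob_space_axioms)

lemma finite_players [simp]: "finite players"
  by (simp add: players_def)

lemma measurable_hand: "i \<in> players \<Longrightarrow> (\<lambda>h. h i) \<in> borel_measurable deal"
  using measurable_component_singleton[of i players "\<lambda>_. hand"]
  by (simp add: deal_def cong: measurable_cong_sets)

lemma measure_drop: "0 \<le> q \<Longrightarrow> q \<le> 1 \<Longrightarrow> measure hand {..<q} = q"
proof -
  assume q: "0 \<le> q" "q \<le> 1"
  then have "{0..1} \<inter> {..<q} = {0..<q}" by auto
  with q show ?thesis by simp
qed

lemma integrable_hand_indicator:
  "A \<in> sets borel \<Longrightarrow> integrable hand (indicator A :: real \<Rightarrow> real)"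
  by (intro integrable_real_indicator) (simp_all add: hand.emeasure_eq_measure del: emeasure_uniform_measure)

text \<open>The truncation at \<open>1\<close> makes the formula valid for every \<open>x\<close>, so that it can be used
  under an integral without an almost-everywhere argument.\<close>

lemma measure_not_beaten:
  assumes "0 \<le> q" "q \<le> 1"
  shows "measure hand {y. y < q \<or> y \<le> x} = min 1 (max q x)"
proof (cases "q \<le> x")
  case True
  then have "{0..1} \<inter> {y. y < q \<or> y \<le> x} = {0..min 1 x}" by auto
  with True assms show ?thesis by simp
next
  case False
  then have "{y. y < q \<or> y \<le> x} = {..<q}" by auto
  with False assms show ?thesis by (simp add: measure_drop del: measure_uniform_measure)
qed

lemma integral_hand_tail:
  fixes f :: "real \<Rightarrow> real"
  assumes a: "0 \<le> a" and f: "continuous_on UNIV f"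
  shows "(\<integral>x. indicator {a..} x * f x \<partial>hand) = integral {a..1} f"
proof -
  have [measurable]: "f \<in> borel_measurable borel"
    using f by (rule borel_measurable_continuous_onI)
  have hand_density: "hand = density lborel (\<lambda>x. ennreal (indicator {0..1} x))"
    by (simp add: uniform_measure_def ennreal_indicator divide_ennreal_def)
  have "(\<integral>x. indicator {a..} x * f x \<partial>hand)
      = (\<integral>x. indicator {0..1} x *\<^sub>R (indicator {a..} x * f x) \<partial>lborel)"
    unfolding hand_density by (rule integral_density) auto
  also have "\<dots> = (\<integral>x\<in>{a..1}. f x \<partial>lborel)"
    unfolding set_lebesgue_integral_def
    using a by (intro Bochner_Integration.integral_cong) (auto simp: indicator_def)
  also have "\<dots> = integral {a..1} f"
    by (intro set_borel_integral_eq_integral borel_integrable_atLeastAtMost'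
          continuous_on_subset[OF f]) simp
  finally show ?thesis .
qed

section \<open>Expectations over the deal\<close>

lemma drops_measurable [measurable]: "i \<in> players \<Longrightarrow> (\<lambda>h. drops p h i) \<in> borel_measurable deal"
  unfolding drops_def
  by (rule measurable_compose[OF measurable_hand borel_measurable_indicator]) auto

lemma integrable_drops: "i \<in> players \<Longrightarrow> integrable deal (\<lambda>h. drops p h i)"
proof (rule deal.integrable_const_bound)
  show "AE h in deal. norm (drops p h i) \<le> 1"
    by (simp add: drops_def)
qed measurable

lemma integrable_prod_drops: "integrable deal (\<lambda>h. \<Prod>i\<in>players. drops p h i)"
proof (rule deal.integrable_const_bound)
  show "AE h in deal. norm (\<Prod>i\<in>players. drops p h i) \<le> 1"
    by (simp add: prod_drops)
qed measurable

text \<open>For an abstract measure space the automation proves this; with the coordinate maps of a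
  deal, which is itself a function space, it mistakes \<open>h i\<close> for an application to be
  decomposed. The coordinates are therefore inserted only afterwards.\<close>

lemma measurable_unbeaten:
  fixes f g k :: "'a \<Rightarrow> real"
  assumes [measurable]: "f \<in> borel_measurable M" "g \<in> borel_measurable M" "k \<in> borel_measurable M"
  shows "(\<lambda>h. of_bool (a \<le> f h \<and> (g h < b \<or> g h \<le> f h) \<and> (k h < c \<or> k h \<le> f h)) :: real)
    \<in> borel_measurable M"
  unfolding of_bool_def by measurable

lemma wins_measurable [measurable]:
  "(\<lambda>h. of_bool (wins p h 1) :: real) \<in> borel_measurable deal"
proof -
  have "wins p h 1 \<longleftrightarrow>
      p 1 \<le> h 1 \<and> (h 2 < p 2 \<or> h 2 \<le> h 1) \<and> (h 3 < p 3 \<or> h 3 \<le> h 1)" for h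
    by (auto simp: wins_1_iff simp del: One_nat_def)
  then show ?thesis
    by (simp only:) (intro measurable_unbeaten measurable_hand; simp add: players_def)
qed

lemma integrable_wins: "integrable deal (\<lambda>h. of_bool (wins p h 1) :: real)"
  by (rule deal.integrable_const_bound[where B = 1]) (auto simp del: One_nat_def)

lemma expectation_drops:
  assumes "i \<in> players" "0 \<le> p i" "p i \<le> 1"
  shows "(\<integral>h. drops p h i \<partial>deal) = p i"
proof -
  have "(\<integral>h. drops p h i \<partial>deal) = (\<integral>x. indicator {..<p i} x \<partial>distr deal hand (\<lambda>h. h i))"
    using assms(1) by (subst integral_distr)
      (simp_all add: drops_def deal_def measurable_component_singleton borel_measurable_indicator)
  also have "distr deal hand (\<lambda>h. h i) = hand"
    unfolding deal_def using assms(1) by (intro distr_PiM_component) (auto intro: hand.prob_space_axioms)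
  finally show ?thesis
    using measure_drop[OF assms(2,3)] by simp
qed

lemma expectation_prod_drops:
  assumes "\<forall>i\<in>players. 0 \<le> p i \<and> p i \<le> 1"
  shows "(\<integral>h. (\<Prod>i\<in>players. drops p h i) \<partial>deal) = (\<Prod>i\<in>players. p i)"
proof -
  have "(\<integral>h. (\<Prod>i\<in>players. drops p h i) \<partial>deal) = (\<Prod>i\<in>players. \<integral>x. indicator {..<p i} x \<partial>hand)"
    unfolding deal_def drops_def
    by (rule hands.product_integral_prod) (auto intro!: integrable_hand_indicator)
  also have "\<dots> = (\<Prod>i\<in>players. p i)"
    using assms measure_drop by (intro prod.cong) auto
  finally show ?thesis .
qed

text \<open>The hand of player 1 is split off by Fubini; for a fixed value of it the other two players
  fail to beat it independently.\<close>

lemma expectation_wins: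
  assumes p: "\<forall>i\<in>players. 0 \<le> p i \<and> p i \<le> 1"
  shows "(\<integral>h. of_bool (wins p h 1) \<partial>deal) = integral {p 1..1} (\<lambda>x. max (p 2) x * max (p 3) x)"
proof -
  let ?safe = "\<lambda>x j. {y. y < p j \<or> y \<le> x}"
  let ?win = "\<lambda>x y. indicator {p 1..} x * (\<Prod>j\<in>{2, 3}. indicator (?safe x j) (y j)) :: real"
  have players_split: "players = {1} \<union> {2, 3}"
    by (auto simp: players_def)
  have given: "(\<integral>y. (\<Prod>j\<in>{2, 3}. indicator (?safe x j) (y j)) \<partial>Pi\<^sub>M {2, 3} (\<lambda>_. hand))
      = (\<Prod>j\<in>{2, 3}. min 1 (max (p j) x))" for x
  proof -
    have "(\<integral>y. (\<Prod>j\<in>{2, 3}. indicator (?safe x j) (y j) :: real) \<partial>Pi\<^sub>M {2, 3} (\<lambda>_. hand))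
        = (\<Prod>j\<in>{2, 3}. \<integral>y. indicator (?safe x j) y \<partial>hand)"
      by (rule hands.product_integral_prod) (auto intro!: integrable_hand_indicator)
    then show ?thesis
      using p by (simp add: measure_not_beaten players_def del: measure_uniform_measure)
  qed
  have "(\<integral>h. of_bool (wins p h 1) \<partial>deal)
      = (\<integral>x. \<integral>y. (of_bool (wins p (merge {1} {2, 3} (x, y)) 1) :: real)
           \<partial>Pi\<^sub>M {2, 3} (\<lambda>_. hand) \<partial>Pi\<^sub>M {1 :: nat} (\<lambda>_. hand))"
    unfolding deal_def players_split
    by (rule hands.product_integral_fold) (use integrable_wins[of p] in \<open>simp_all add: deal_def players_split del: One_nat_def\<close>)
  also have "\<dots> = (\<integral>x. \<integral>y. ?win (x 1) y \<partial>Pi\<^sub>M {2, 3} (\<lambda>_. hand) \<partial>Pi\<^sub>M {1 :: nat} (\<lambda>_. hand))"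
    by (intro Bochner_Integration.integral_cong refl)
      (auto simp: wins_1_iff merge_def indicator_def simp del: One_nat_def)
  also have "\<dots> = (\<integral>x. indicator {p 1..} (x 1) * (\<Prod>j\<in>{2, 3}. min 1 (max (p j) (x 1)))
      \<partial>Pi\<^sub>M {1 :: nat} (\<lambda>_. hand))"
    by (simp only: integral_mult_right_zero given)
  also have "\<dots> = (\<integral>x. indicator {p 1..} x * (\<Prod>j\<in>{2, 3}. min 1 (max (p j) x)) \<partial>hand)"
    by (rule hands.product_integral_singleton) simp
  also have "\<dots> = integral {p 1..1} (\<lambda>x. \<Prod>j\<in>{2, 3}. min 1 (max (p j) x))"
    using p by (intro integral_hand_tail) (auto intro!: continuous_intros simp: players_def)
  also have "\<dots> = integral {p 1..1} (\<lambda>x. max (p 2) x * max (p 3) x)"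
    using p by (intro integral_cong) (auto simp: players_def)
  finally show ?thesis .
qed

lemma beta_eq:
  assumes "\<forall>i\<in>players. 0 \<le> p i \<and> p i \<le> 1"
  shows "beta p = 2 - p 1 - p 2 - p 3 + 2 * p 1 * p 2 * p 3"
proof -
  have "beta p = 2 - (\<Sum>i\<in>players. \<integral>h. drops p h i \<partial>deal)
      + 2 * (\<integral>h. (\<Prod>i\<in>players. drops p h i) \<partial>deal)"
    unfolding beta_def stakes_factor_eq
    by (simp add: integrable_drops integrable_prod_drops deal.prob_space)
  also have "\<dots> = 2 - (\<Sum>i\<in>players. p i) + 2 * (\<Prod>i\<in>players. p i)"
    using assms by (simp add: expectation_drops expectation_prod_drops)
  finally show ?thesis
    by (simp add: players_def)
qed

lemma alpha_eq:
  assumes "\<forall>i\<in>players. 0 \<le> p i \<and> p i \<le> 1"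
  shows "alpha p = 2 * p 1 - p 2 - p 3 - 2 + 2 * p 1 * p 2 * p 3
      + 6 * integral {p 1..1} (\<lambda>x. max (p 2) x * max (p 3) x)"
proof -
  have 1: "1 \<in> players"
    by (simp add: players_def)
  have "alpha p = 3 * (\<integral>h. drops p h 1 \<partial>deal) - 2 - (\<Sum>i\<in>players. \<integral>h. drops p h i \<partial>deal)
      + 2 * (\<integral>h. (\<Prod>i\<in>players. drops p h i) \<partial>deal) + 6 * (\<integral>h. of_bool (wins p h 1) \<partial>deal)"
    unfolding alpha_def immediate_return_eq[OF 1]
    by (simp add: 1 integrable_drops integrable_prod_drops integrable_wins deal.prob_space
        del: One_nat_def)
  also have "\<dots> = 3 * p 1 - 2 - (\<Sum>i\<in>players. p i) + 2 * (\<Prod>i\<in>players. p i)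
      + 6 * integral {p 1..1} (\<lambda>x. max (p 2) x * max (p 3) x)"
    using assms 1 by (simp add: expectation_drops expectation_prod_drops expectation_wins
        del: One_nat_def)
  finally show ?thesis
    by (simp add: players_def)
qed

section \<open>The winning probability in closed form\<close>

lemma has_integral_monomial:
  fixes u v :: real
  assumes "u \<le> v"
  shows "((\<lambda>x. x ^ n) has_integral (v ^ Suc n - u ^ Suc n) / Suc n) {u..v}"
proof -
  have "((\<lambda>x. x ^ n) has_integral (v ^ Suc n / Suc n - u ^ Suc n / Suc n)) {u..v}"
    using assms
    by (intro fundamental_theorem_of_calculus)
      (auto intro!: derivative_eq_intros simp flip: has_real_derivative_iff_has_vector_derivative
         simp del: power_Suc)
  then show ?thesis
    by (simp add: diff_divide_distrib)
qed

text \<open>The three positions of player 1's threshold \<open>a\<close> relative to the opposing thresholds \<open>b\<close> and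
  \<open>c\<close>: above both, between them, below both. Each position adds one piece below those of the previous one.\<close>

lemma integral_max_above:
  fixes a b c :: real
  assumes "b \<le> a" "c \<le> a" "a \<le> 1"
  shows "((\<lambda>x. max b x * max c x) has_integral (1 - a ^ 3) / 3) {a..1}"
  using has_integral_monomial[OF assms(3), of 2] assms
  by (subst has_integral_cong[where g = "\<lambda>x. x ^ 2"])
    (auto simp: power2_eq_square numeral_eq_Suc)

lemma integral_max_between:
  fixes a b c :: real
  assumes "b \<le> a" "a \<le> c" "c \<le> 1"
  shows "((\<lambda>x. max b x * max c x) has_integral c * (c ^ 2 - a ^ 2) / 2 + (1 - c ^ 3) / 3) {a..1}"
proof (rule has_integral_combine[OF assms(2,3)])
  show "((\<lambda>x. max b x * max c x) has_integral c * (c ^ 2 - a ^ 2) / 2) {a..c}"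
    using has_integral_mult_right[OF has_integral_monomial[OF assms(2), of 1], of c] assms
    by (subst has_integral_cong[where g = "\<lambda>x. c * x"]) (auto simp: numeral_eq_Suc)
  show "((\<lambda>x. max b x * max c x) has_integral (1 - c ^ 3) / 3) {c..1}"
    using assms by (intro integral_max_above) auto
qed

lemma integral_max_below:
  fixes a b c :: real
  assumes "a \<le> b" "b \<le> c" "c \<le> 1"
  shows "((\<lambda>x. max b x * max c x) has_integral
      b * c * (b - a) + (c * (c ^ 2 - b ^ 2) / 2 + (1 - c ^ 3) / 3)) {a..1}"
proof (rule has_integral_combine)
  show "((\<lambda>x. max b x * max c x) has_integral b * c * (b - a)) {a..b}"
    using has_integral_const_real[of "b * c" a b] assms
    by (subst has_integral_cong[where g = "\<lambda>x. b * c"]) (auto simp: mult_ac)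
  show "((\<lambda>x. max b x * max c x) has_integral c * (c ^ 2 - b ^ 2) / 2 + (1 - c ^ 3) / 3) {b..1}"
    using assms by (intro integral_max_between) auto
qed (use assms in auto)

section \<open>The payoff\<close>

lemma (in pair_sigma_finite) integrable_mult_fst_snd:
  fixes f :: "'a \<Rightarrow> real" and g :: "'b \<Rightarrow> real"
  assumes f: "integrable M1 f" and g: "integrable M2 g"
  shows "integrable (M1 \<Otimes>\<^sub>M M2) (\<lambda>(x, y). f x * g y)"
proof (rule Fubini_integrable)
  show "(\<lambda>(x, y). f x * g y) \<in> borel_measurable (M1 \<Otimes>\<^sub>M M2)"
    using f g by measurable
  show "integrable M1 (\<lambda>x. \<integral>y. norm (case (x, y) of (x, y) \<Rightarrow> f x * g y) \<partial>M2)"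
    using f by (simp add: abs_mult)
  show "AE x in M1. integrable M2 (\<lambda>y. case (x, y) of (x, y) \<Rightarrow> f x * g y)"
    using g by simp
qed

lemma (in pair_sigma_finite) integral_mult_fst_snd:
  fixes f :: "'a \<Rightarrow> real" and g :: "'b \<Rightarrow> real"
  assumes f: "integrable M1 f" and g: "integrable M2 g"
  shows "(\<integral>(x, y). f x * g y \<partial>(M1 \<Otimes>\<^sub>M M2)) = (\<integral>x. f x \<partial>M1) * (\<integral>y. g y \<partial>M2)"
  using integral_fst'[OF integrable_mult_fst_snd[OF f g]] by simp

lemma payoff_eq:
  assumes R: "prob_space R" and W: "integrable R W"
  shows "payoff R W p = alpha p + beta p * (\<integral>w. W w \<partial>R)"
proof -
  interpret R: prob_space R by fact
  interpret pair_sigma_finite deal R ..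
  have 1: "1 \<in> players"
    by (simp add: players_def)
  have ret: "integrable deal (\<lambda>h. immediate_return p h 1)"
    unfolding immediate_return_eq[OF 1]
    by (simp add: 1 integrable_drops integrable_prod_drops integrable_wins del: One_nat_def)
  have stakes: "integrable deal (stakes_factor p)"
    unfolding stakes_factor_eq[abs_def] by (simp add: integrable_drops integrable_prod_drops)
  have one: "integrable R (\<lambda>_. 1 :: real)"
    by simp
  \<comment> \<open>The immediate return is read as a product with the constant \<open>1\<close> on the replay side, so
    that both summands factorise by the same rule.\<close>
  have "payoff R W p = (\<integral>z. (case z of (h, w) \<Rightarrow> immediate_return p h 1 * 1)
      + (case z of (h, w) \<Rightarrow> stakes_factor p h * W w) \<partial>(deal \<Otimes>\<^sub>M R))"
    unfolding payoff_def by (intro Bochner_Integration.integral_cong) auto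
  also have "\<dots> = (\<integral>(h, w). immediate_return p h 1 * 1 \<partial>(deal \<Otimes>\<^sub>M R))
      + (\<integral>(h, w). stakes_factor p h * W w \<partial>(deal \<Otimes>\<^sub>M R))"
    by (rule Bochner_Integration.integral_add[OF integrable_mult_fst_snd[OF ret one]
          integrable_mult_fst_snd[OF stakes W]])
  also have "\<dots> = alpha p + beta p * (\<integral>w. W w \<partial>R)"
    unfolding integral_mult_fst_snd[OF ret one] integral_mult_fst_snd[OF stakes W]
    by (simp add: alpha_def beta_def R.prob_space)
  finally show ?thesis .
qed

theorem proposition6p1:
  fixes p :: "nat \<Rightarrow> real" and R :: "'a measure" and W :: "'a \<Rightarrow> real" and V :: real
  assumes "\<forall>i\<in>players. 0 \<le> p i \<and> p i \<le> 1"
    and "prob_space R" and "integrable R W" and "V = (\<integral>w. W w \<partial>R)"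
  shows "(payoff R W p = alpha p + beta p * V) \<and>
      (beta p = 2 - p 1 - p 2 - p 3 + 2 * p 1 * p 2 * p 3) \<and>
      (p 1 < p 2 \<and> p 2 < p 3 \<longrightarrow>
        alpha p = 2 * p 1 - p 2 - p 3 + p 3 ^ 3 + 3 * p 2 ^ 2 * p 3 - 4 * p 1 * p 2 * p 3) \<and>
      (p 1 < p 3 \<and> p 3 < p 2 \<longrightarrow>
        alpha p = 2 * p 1 - p 3 - p 2 + p 2 ^ 3 + 3 * p 3 ^ 2 * p 2 - 4 * p 1 * p 2 * p 3) \<and>
      (p 2 < p 1 \<and> p 1 < p 3 \<longrightarrow>
        alpha p = 2 * p 1 - p 2 - p 3 + p 3 ^ 3 - 3 * p 1 ^ 2 * p 3 + 2 * p 1 * p 2 * p 3) \<and>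
      (p 3 < p 1 \<and> p 1 < p 2 \<longrightarrow>
        alpha p = 2 * p 1 - p 2 - p 3 + p 2 ^ 3 - 3 * p 1 ^ 2 * p 2 + 2 * p 1 * p 2 * p 3) \<and>
      (p 2 < p 3 \<and> p 3 < p 1 \<longrightarrow>
        alpha p = 2 * p 1 - p 2 - p 3 - 2 * p 1 ^ 3 + 2 * p 1 * p 2 * p 3) \<and>
      (p 3 < p 2 \<and> p 2 < p 1 \<longrightarrow>
        alpha p = 2 * p 1 - p 2 - p 3 - 2 * p 1 ^ 3 + 2 * p 1 * p 2 * p 3)"
proof -
  have le1: "p 1 \<le> 1" "p 2 \<le> 1" "p 3 \<le> 1"
    using assms(1) by (auto simp: players_def)
  note alpha = alpha_eq[OF assms(1)]
  have swap: "(\<lambda>x. max (p 2) x * max (p 3) x) = (\<lambda>x. max (p 3) x * max (p 2) x)"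
    by (simp add: mult.commute)
  show ?thesis
  proof (intro conjI impI)
    show "payoff R W p = alpha p + beta p * V"
      using payoff_eq[OF assms(2,3)] assms(4) by simp
    show "beta p = 2 - p 1 - p 2 - p 3 + 2 * p 1 * p 2 * p 3"
      by (rule beta_eq[OF assms(1)])
  next
    assume "p 1 < p 2 \<and> p 2 < p 3"
    then show "alpha p = 2 * p 1 - p 2 - p 3 + p 3 ^ 3 + 3 * p 2 ^ 2 * p 3 - 4 * p 1 * p 2 * p 3"
      using integral_unique[OF integral_max_below[of "p 1" "p 2" "p 3"]] le1 alpha
      by (simp add: field_simps power2_eq_square power3_eq_cube)
  next
    assume "p 1 < p 3 \<and> p 3 < p 2"
    then show "alpha p = 2 * p 1 - p 3 - p 2 + p 2 ^ 3 + 3 * p 3 ^ 2 * p 2 - 4 * p 1 * p 2 * p 3"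
      using integral_unique[OF integral_max_below[of "p 1" "p 3" "p 2"]] le1 alpha[unfolded swap]
      by (simp add: field_simps power2_eq_square power3_eq_cube)
  next
    assume "p 2 < p 1 \<and> p 1 < p 3"
    then show "alpha p = 2 * p 1 - p 2 - p 3 + p 3 ^ 3 - 3 * p 1 ^ 2 * p 3 + 2 * p 1 * p 2 * p 3"
      using integral_unique[OF integral_max_between[of "p 2" "p 1" "p 3"]] le1 alpha
      by (simp add: field_simps power2_eq_square power3_eq_cube)
  next
    assume "p 3 < p 1 \<and> p 1 < p 2"
    then show "alpha p = 2 * p 1 - p 2 - p 3 + p 2 ^ 3 - 3 * p 1 ^ 2 * p 2 + 2 * p 1 * p 2 * p 3"
      using integral_unique[OF integral_max_between[of "p 3" "p 1" "p 2"]] le1 alpha[unfolded swap]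
      by (simp add: field_simps power2_eq_square power3_eq_cube)
  next
    assume "p 2 < p 3 \<and> p 3 < p 1"
    then show "alpha p = 2 * p 1 - p 2 - p 3 - 2 * p 1 ^ 3 + 2 * p 1 * p 2 * p 3"
      using integral_unique[OF integral_max_above[of "p 2" "p 1" "p 3"]] le1 alpha
      by (simp add: field_simps)
  next
    assume "p 3 < p 2 \<and> p 2 < p 1"
    then show "alpha p = 2 * p 1 - p 2 - p 3 - 2 * p 1 ^ 3 + 2 * p 1 * p 2 * p 3"
      using integral_unique[OF integral_max_above[of "p 2" "p 1" "p 3"]] le1 alpha
      by (simp add: field_simps)
  qed
qed

end
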